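(* For any $t \in o(\sqrt{n})$, $\mathrm{DACA}(t) = \mathrm{DACA}(O(1))$.
   Context: A cellular automaton (CA) is $C=(Q,\delta,\Sigma)$ with finite state set $Q$, local rule $\delta\colon Q^3\to Q$, input alphabet $\Sigma\subseteq Q$, and an inactive state $q\in Q\setminus\Sigma$ with $\delta(z_1,z_2,z_3)=q$ iff $z_2=q$; the global map is $\Delta(c)(z)=\delta(c(z-1),c(z),c(z+1))$ on $Q^{\mathbb{Z}}$. For input $w\in\Sigma^+$ the initial configuration $c_0$ has $c_0(i)=w(i)$ for $0\le i<|w|$ and $q$ elsewhere. For $F\subseteq Q\setminus\{q\}$, a configuration $\Delta^\tau(c_0)$ is $F$-final if all its cells are in $F\cup\{q\}$. A decider ACA (DACA) is a CA with nonempty disjoint sets $A,R\subseteq Q\setminus\{q\}$ of accept and reject states such that every input $w\in\Sigma^+$ leads to an $A$-final or an $R$-final configuration; $C$ accepts $w$ if it reaches an $A$-final configuration with no earlier $R$-final configuration, and rejects $w$ if it reaches an $R$-final configuration with no earlier $A$-final one. The time taken on $w$ is the number of steps until the first $A$- or $R$-final configuration. $L(C)$ is the set of accepted words. For $t\colon\mathbb{N}_+\to\mathbb{N}_0$, $\mathrm{DACA}(t)$ is the class of $L(C)$ for DACAs deciding every input $w$ within $t(|w|)$ steps; $\mathrm{DACA}(O(1))$ is the union over constant $t$.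
   Formalization: With the literal bound t(|w|) the equality fails for every t in o(√n) (e.g. t=0: {a} is in DACA(O(1)), not in DACA(0)); proved instead: DACA(t) ⊆ DACA(O(1)) for each t in o(√n), and the union of DACA(t) over all t in o(√n) equals DACA(O(1)). *)

theory Defs
  imports Complex_Main "HOL-Library.Landau_Symbols" "HOL-Library.Infinite_Typeclass"
begin

record 's ca =
  states :: "'s set"
  rule :: "'s \<Rightarrow> 's \<Rightarrow> 's \<Rightarrow> 's"
  alphabet :: "'s set"
  inactive :: 's

definition is_CA :: "('s, 'x) ca_scheme \<Rightarrow> bool" where
  "is_CA C \<longleftrightarrow>
     finite (states C) \<and>
     alphabet C \<subseteq> states C \<and>
     inactive C \<in> states C - alphabet C \<and>
     (\<forall>x\<in>states C. \<forall>y\<in>states C. \<forall>z\<in>states C.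
        rule C x y z \<in> states C \<and> (rule C x y z = inactive C \<longleftrightarrow> y = inactive C))"

definition global_map :: "('s, 'x) ca_scheme \<Rightarrow> (int \<Rightarrow> 's) \<Rightarrow> (int \<Rightarrow> 's)" where
  "global_map C c = (\<lambda>z. rule C (c (z - 1)) (c z) (c (z + 1)))"

definition initial_config :: "('s, 'x) ca_scheme \<Rightarrow> 's list \<Rightarrow> (int \<Rightarrow> 's)" where
  "initial_config C w =
     (\<lambda>i. if 0 \<le> i \<and> i < int (length w) then w ! nat i else inactive C)"

definition config_at :: "('s, 'x) ca_scheme \<Rightarrow> 's list \<Rightarrow> nat \<Rightarrow> (int \<Rightarrow> 's)" where
  "config_at C w \<tau> = (global_map C ^^ \<tau>) (initial_config C w)"

definition final_config :: "('s, 'x) ca_scheme \<Rightarrow> 's set \<Rightarrow> (int \<Rightarrow> 's) \<Rightarrow> bool" where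
  "final_config C F c \<longleftrightarrow> (\<forall>z. c z \<in> F \<union> {inactive C})"

definition inputs :: "('s, 'x) ca_scheme \<Rightarrow> 's list set" where
  "inputs C = lists (alphabet C) - {[]}"

record 's daca = "'s ca" +
  accept :: "'s set"
  reject :: "'s set"

definition halted_at :: "'s daca \<Rightarrow> 's list \<Rightarrow> nat \<Rightarrow> bool" where
  "halted_at C w \<tau> \<longleftrightarrow>
     final_config C (accept C) (config_at C w \<tau>) \<or>
     final_config C (reject C) (config_at C w \<tau>)"

definition is_DACA :: "'s daca \<Rightarrow> bool" where
  "is_DACA C \<longleftrightarrow>
     is_CA C \<and>
     accept C \<noteq> {} \<and> accept C \<subseteq> states C - {inactive C} \<and>
     reject C \<noteq> {} \<and> reject C \<subseteq> states C - {inactive C} \<and>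
     accept C \<inter> reject C = {} \<and>
     (\<forall>w\<in>inputs C. \<exists>\<tau>. halted_at C w \<tau>)"

definition accepts :: "'s daca \<Rightarrow> 's list \<Rightarrow> bool" where
  "accepts C w \<longleftrightarrow>
     (\<exists>\<tau>. final_config C (accept C) (config_at C w \<tau>) \<and>
          (\<forall>\<tau>'<\<tau>. \<not> final_config C (reject C) (config_at C w \<tau>')))"

definition language :: "'s daca \<Rightarrow> 's list set" where
  "language C = {w \<in> inputs C. accepts C w}"

definition time_on :: "'s daca \<Rightarrow> 's list \<Rightarrow> nat" where
  "time_on C w = (LEAST \<tau>. halted_at C w \<tau>)"

text \<open>
  Since HOL cannot quantify over types, all state sets are finite subsets of one universe
  \<open>'s\<close>.  This universe is required to be infinite, so that every finite extension of a given
  alphabet occurs as a state set, up to renaming.  The value of a time bound at \<open>0\<close> is never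
  used because inputs are nonempty.
\<close>

definition DACA :: "(nat \<Rightarrow> nat) \<Rightarrow> 's::infinite list set set" where
  "DACA t = {language C | C :: 's daca.
     is_DACA C \<and> (\<forall>w\<in>inputs C. time_on C w \<le> t (length w))}"

definition DACA_class :: "(nat \<Rightarrow> nat) set \<Rightarrow> 's::infinite list set set" where
  "DACA_class T = (\<Union>t\<in>T. DACA t)"

definition constant_bounds :: "(nat \<Rightarrow> nat) set" where
  "constant_bounds = {\<lambda>_. k | k. True}"

text \<open>
  \<open>DACA t\<close> takes the bound \<open>t\<close> literally, at every input length.  Hence no single
  \<open>t \<in> o(sqrt n)\<close> satisfies \<open>DACA t = DACA_class constant_bounds\<close>: the language of all
  \<open>a^i\<close> with \<open>1 \<le> i \<le> k\<close> is decidable in constantly many steps (depending on \<open>k\<close>), but on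
  \<open>a^k\<close> and \<open>a^(k+1)\<close> every cell state up to any step \<open>\<tau>\<close> with \<open>2\<tau> < k\<close> occurs for both
  inputs, so that \<open>max (t k) (t (k+1)) \<ge> k/2\<close> would have to hold for every \<open>k\<close>.  The equality
  is one of complexity classes, between all bounds in \<open>o(sqrt n)\<close> and all constant bounds;
  for a single \<open>t\<close> it amounts to an inclusion.
\<close>

definition little_o_sqrt :: "(nat \<Rightarrow> nat) set" where
  "little_o_sqrt = {t. (\<lambda>n. real (t n)) \<in> o(\<lambda>n. sqrt (real n))}"

end

theory Submission
  imports Defs
begin

text \<open>
  A decider that is not constant-time needs time \<open>\<Omega>(sqrt n)\<close> on infinitely many inputs.  If it has
  not halted on \<open>w\<close> after any of the steps \<open>0, \<dots>, i\<close>, then each of these steps has one cell that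
  is not accepting and one that is not rejecting.  These \<open>2(i+1)\<close> cells depend only on their
  radius-\<open>i\<close> neighbourhoods, so every symbol of \<open>w\<close> outside the neighbourhoods can be deleted
  without making the automaton halt earlier.  Hence a shortest word that is undecided up to
  step \<open>i\<close> has length at most \<open>2(i+1)(2i+1)\<close>, and a time bound in \<open>o(sqrt n)\<close> limits \<open>i\<close>.
\<close>

text \<open>Information travels one cell per step, so \<tau> steps see only radius \<tau>. The shift
  \<open>s\<close> is there because deleting a symbol moves everything to its right by one
  cell.\<close>

lemma global_map_funpow_local:
  assumes "\<And>k. \<bar>k - z\<bar> \<le> int \<tau> \<Longrightarrow> c k = c' (k + s)"
  shows "(global_map C ^^ \<tau>) c z = (global_map C ^^ \<tau>) c' (z + s)"
  using assms
proof (induction \<tau> arbitrary: z)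
  case 0
  then show ?case by simp
next
  case (Suc \<tau>)
  have "(global_map C ^^ \<tau>) c y = (global_map C ^^ \<tau>) c' (y + s)" if "\<bar>y - z\<bar> \<le> 1" for y
    using that by (intro Suc.IH Suc.prems) auto
  from this[of "z - 1"] this[of z] this[of "z + 1"] show ?case
    by (simp add: global_map_def[of C "(global_map C ^^ \<tau>) _"] algebra_simps)
qed

lemma initial_config_delete:
  assumes "p < length w"
  shows "initial_config C (take p w @ drop (Suc p) w) z =
         initial_config C w (if z < int p then z else z + 1)"
proof -
  have "(take p w @ drop (Suc p) w) ! nat z = w ! nat (z + 1)"
    if "int p \<le> z" "z + 1 < int (length w)"
  proof -
    from that have "nat (z + 1) = Suc p + (nat z - p)" "\<not> nat z < p" by linarith+
    with that assms show ?thesis by (simp add: nth_append)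
  qed
  with assms show ?thesis
    by (auto simp: initial_config_def nth_append)
qed

text \<open>A radius-\<tau> neighbourhood that misses \<open>p\<close> lies wholly on one side of
  it, so the deletion either leaves it in place or moves it left as one block.\<close>

lemma config_at_delete:
  assumes "p < length w" and far: "int \<tau> < \<bar>z - int p\<bar>"
  shows "config_at C w \<tau> z =
         config_at C (take p w @ drop (Suc p) w) \<tau> (if z < int p then z else z - 1)"
proof -
  define s where "s = (if z < int p then 0 else - 1 :: int)"
  have "config_at C w \<tau> z = config_at C (take p w @ drop (Suc p) w) \<tau> (z + s)"
    unfolding config_at_def
    by (rule global_map_funpow_local)
      (use far in \<open>auto simp: initial_config_delete[OF assms(1)] s_def\<close>)
  then show ?thesis by (simp add: s_def split: if_splits)
qed

lemma undecided_delete: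
  assumes long: "2 * (i + 1) * (2 * i + 1) < length w"
    and undecided: "\<And>j. j \<le> i \<Longrightarrow> \<not> halted_at C w j"
  obtains p where "p < length w"
    and "\<And>j. j \<le> i \<Longrightarrow> \<not> halted_at C (take p w @ drop (Suc p) w) j"
proof -
  have "\<exists>z. config_at C w j z \<notin> F \<union> {inactive C}"
    if "j \<le> i" "F \<in> {accept C, reject C}" for j F
    using undecided[OF that(1)] that(2) by (auto simp: halted_at_def final_config_def)
  then obtain x where
    x: "\<And>j F. j \<le> i \<Longrightarrow> F \<in> {accept C, reject C} \<Longrightarrow>
          config_at C w j (x j F) \<notin> F \<union> {inactive C}"
    by metis
  \<comment> \<open>One witness cell per step and per final set. All neighbourhoods get the largest
    radius \<open>i\<close>, so that a single position outside \<open>J\<close> serves every step up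
    to \<open>i\<close>.\<close>
  let ?I = "{..i} \<times> {accept C, reject C}"
  define J where "J = (\<Union>(j, F)\<in>?I. {x j F - int i..x j F + int i})"
  have "card J \<le> (\<Sum>(j, F)\<in>?I. card {x j F - int i..x j F + int i})"
    unfolding J_def by (rule order_trans[OF card_UN_le]) (auto simp: case_prod_unfold)
  also have "\<dots> = card ?I * (2 * i + 1)"
    by (simp add: case_prod_unfold nat_add_distrib nat_mult_distrib)
  \<comment> \<open>Only an inequality: \<open>C\<close> is not assumed to be a decider here, so its
    accept and reject sets may coincide.\<close>
  also have "\<dots> \<le> 2 * (i + 1) * (2 * i + 1)"
    by (intro mult_right_mono) (auto simp: card_cartesian_product card_insert_if)
  also note long
  finally have "card J < card (int ` {..<length w})"
    by (simp add: card_image)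
  moreover have "finite J" by (auto simp: J_def)
  ultimately have "\<not> int ` {..<length w} \<subseteq> J"
    using card_mono leD by blast
  then obtain p where p: "p < length w" "int p \<notin> J" by auto
  have "\<not> halted_at C (take p w @ drop (Suc p) w) j" if "j \<le> i" for j
  proof -
    have "\<exists>z. config_at C (take p w @ drop (Suc p) w) j z \<notin> F \<union> {inactive C}"
      if F: "F \<in> {accept C, reject C}" for F
    proof -
      have "int p \<notin> {x j F - int i..x j F + int i}"
        using p(2) F \<open>j \<le> i\<close> unfolding J_def by blast
      then have "int j < \<bar>x j F - int p\<bar>" using \<open>j \<le> i\<close> by auto
      from config_at_delete[OF p(1) this, of C] x[OF \<open>j \<le> i\<close> F] show ?thesis by metis
    qed
    then show ?thesis unfolding halted_at_def final_config_def by blast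
  qed
  with p(1) that show thesis by blast
qed

lemma short_undecided_input:
  assumes "w \<in> inputs C" and "\<And>j. j \<le> i \<Longrightarrow> \<not> halted_at C w j"
  obtains v where "v \<in> inputs C" and "length v \<le> 2 * (i + 1) * (2 * i + 1)"
    and "\<And>j. j \<le> i \<Longrightarrow> \<not> halted_at C v j"
  using assms
proof (induction "length w" arbitrary: w thesis rule: less_induct)
  case less
  show ?case
  proof (cases "length w \<le> 2 * (i + 1) * (2 * i + 1)")
    case True
    then show ?thesis using less.prems by blast
  next
    case False
    then have "2 * (i + 1) * (2 * i + 1) < length w" by (simp only: not_le)
    from undecided_delete[OF this less.prems(3)]
    obtain p where p: "p < length w"
      "\<And>j. j \<le> i \<Longrightarrow> \<not> halted_at C (take p w @ drop (Suc p) w) j"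
      by blast
    let ?w = "take p w @ drop (Suc p) w"
    have len: "length ?w = length w - 1" using p(1) by simp
    \<comment> \<open>The length bound is at least 2, so a word exceeding it cannot become empty by
      one deletion and remains an input.\<close>
    have "2 \<le> length w" using False by simp
    then have "length ?w \<noteq> 0" unfolding len by linarith
    then have "?w \<noteq> []" by (rule contrapos_nn) (simp only: list.size)
    moreover have "set ?w \<subseteq> set w" by (auto dest: in_set_takeD in_set_dropD)
    ultimately have "?w \<in> inputs C"
      using less.prems(2) by (auto simp: inputs_def in_lists_conv_set)
    moreover have "length ?w < length w" using len p(1) by simp
    ultimately show ?thesis using less.hyps less.prems(1) p(2) by blast
  qed
qed

lemma short_slow_input:
  assumes "is_DACA C" "w \<in> inputs C" "i < time_on C w"
  obtains v where "v \<in> inputs C" and "length v \<le> 2 * (i + 1) * (2 * i + 1)"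
    and "i < time_on C v"
proof -
  have "\<not> halted_at C w j" if "j \<le> i" for j
    using assms(3) that not_less_Least[of j "halted_at C w"] by (simp add: time_on_def)
  then obtain v where v: "v \<in> inputs C" "length v \<le> 2 * (i + 1) * (2 * i + 1)"
    "\<And>j. j \<le> i \<Longrightarrow> \<not> halted_at C v j"
    using short_undecided_input[OF assms(2)] by blast
  \<comment> \<open>\<open>time_on\<close> is a \<open>LEAST\<close>, which says nothing about
    \<open>v\<close> unless \<open>v\<close> halts at some step; the decider property provides
    this.\<close>
  have "halted_at C v (time_on C v)"
    using assms(1) v(1) unfolding time_on_def is_DACA_def by (meson LeastI_ex)
  then have "i < time_on C v" using v(3) by (meson not_le)
  with v that show thesis by blast
qed

lemma little_o_sqrt_time_bounded:
  assumes "t \<in> little_o_sqrt" "is_DACA C"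
    and time: "\<And>w. w \<in> inputs C \<Longrightarrow> time_on C w \<le> t (length w)"
  shows "\<exists>k. \<forall>w\<in>inputs C. time_on C w \<le> k"
proof -
  \<comment> \<open>The short slow word found below has length at most (2(k+1))^2, so the factor 1/4
    bounds its time by (k+1)/2, which is at most k once k \<ge> 1.\<close>
  have "eventually (\<lambda>n. real (t n) \<le> 1 / 4 * sqrt (real n)) sequentially"
    using landau_o.smallD[of "\<lambda>n. real (t n)" sequentially "\<lambda>n. sqrt (real n)" "1 / 4"] assms(1)
    by (simp add: little_o_sqrt_def)
  then obtain N where N: "\<And>n. n \<ge> N \<Longrightarrow> real (t n) \<le> 1 / 4 * sqrt (real n)"
    by (auto simp: eventually_sequentially)
  \<comment> \<open>Dominating \<open>t\<close> below \<open>N\<close> forces any input slower than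
    \<open>k\<close> to have length at least \<open>N\<close>. The inserted 1 gives k \<ge> 1 and
    keeps \<open>Max\<close> defined when N = 0.\<close>
  define k where "k = Max (insert 1 (t ` {..<N}))"
  have k: "1 \<le> k" "\<And>n. n < N \<Longrightarrow> t n \<le> k" by (auto simp: k_def)
  have "time_on C w \<le> k" if w: "w \<in> inputs C" for w
  proof (rule ccontr)
    assume "\<not> time_on C w \<le> k"
    then have "k < time_on C w" by simp
    from short_slow_input[OF assms(2) w this] obtain v where v: "v \<in> inputs C" "length v \<le> 2 * (k + 1) * (2 * k + 1)"
      "k < time_on C v"
      by blast
    then have less: "k < t (length v)" using time by fastforce
    then have "N \<le> length v" using k(2) by (meson not_le)
    then have "real (t (length v)) \<le> 1 / 4 * sqrt (real (length v))" by (rule N)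
    moreover have "length v \<le> (2 * (k + 1))\<^sup>2"
      by (rule order_trans[OF v(2)]) (simp add: power2_eq_square)
    then have "real (length v) \<le> (2 * (real k + 1))\<^sup>2"
      by (simp add: add.commute flip: of_nat_le_iff[where ?'a = real])
    then have "sqrt (real (length v)) \<le> 2 * (real k + 1)"
      by (intro real_le_lsqrt) auto
    ultimately show False using less k(1) by simp
  qed
  then show ?thesis by blast
qed

lemma DACA_little_o_sqrt_subset:
  assumes "t \<in> little_o_sqrt"
  shows "DACA t \<subseteq> DACA_class constant_bounds"
proof
  fix L :: "'a list set"
  assume "L \<in> DACA t"
  then obtain C where C: "L = language C" "is_DACA C"
    "\<And>w. w \<in> inputs C \<Longrightarrow> time_on C w \<le> t (length w)"
    by (auto simp: DACA_def)
  from little_o_sqrt_time_bounded[OF assms C(2,3)]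
  obtain k where "\<forall>w\<in>inputs C. time_on C w \<le> k" by blast
  with C(1,2) have "L \<in> DACA (\<lambda>_. k)" by (auto simp: DACA_def)
  then show "L \<in> DACA_class constant_bounds"
    by (auto simp: DACA_class_def constant_bounds_def)
qed

lemma constant_bounds_subset_little_o_sqrt: "constant_bounds \<subseteq> little_o_sqrt"
proof -
  have "filterlim (\<lambda>n. sqrt (real n)) at_top sequentially"
    by (rule filterlim_compose[OF sqrt_at_top filterlim_real_sequentially])
  then have "filterlim (\<lambda>n. norm (sqrt (real n))) at_top sequentially" by simp
  \<comment> \<open>A constant divided by sqrt n tends to 0; the quotient criterion needs a nonzero
    divisor, hence the start at n = 1.\<close>
  then show ?thesis
    by (auto simp: constant_bounds_def little_o_sqrt_def
        intro!: smalloI_tendsto tendsto_divide_0[OF tendsto_const]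
          filterlim_at_top_imp_at_infinity eventually_sequentiallyI[of 1])
qed

theorem theorem9:
  shows "(\<forall>t\<in>little_o_sqrt.
            (DACA t :: 's::infinite list set set) \<subseteq> DACA_class constant_bounds) \<and>
         (DACA_class little_o_sqrt :: 's list set set) = DACA_class constant_bounds"
proof (intro conjI ballI subset_antisym)
  show "DACA t \<subseteq> DACA_class constant_bounds" if "t \<in> little_o_sqrt" for t
    using that by (rule DACA_little_o_sqrt_subset)
  then show "DACA_class little_o_sqrt \<subseteq> DACA_class constant_bounds"
    unfolding DACA_class_def[of little_o_sqrt] by blast
  show "DACA_class constant_bounds \<subseteq> DACA_class little_o_sqrt"
    unfolding DACA_class_def using constant_bounds_subset_little_o_sqrt by blast
qed

end
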